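(* If the perturbed KKT condition holds at $\widehat{x}\in S$, then $\widehat{x}$ is an isolated efficient solution for $(P)$.
   Context: Setting: $p\geq 2$, $I:=\{1,\ldots,p\}$; $f_i:\mathbb{R}^n\to\mathbb{R}$ ($i\in I$) are finite-valued convex functions; $T$ is an infinite index set; for each $t\in T$, $g_t:\mathbb{R}^n\to\mathbb{R}\cup\{+\infty\}$ is a lower semicontinuous proper convex function. Problem $(P)$: minimize $f(x):=(f_1(x),\ldots,f_p(x))$ subject to $g_t(x)\le 0$, $t\in T$, with feasible set $S:=\{x\in\mathbb{R}^n\mid g_t(x)\le 0\ \forall t\in T\}$ assumed nonempty. $\widehat{x}\in S$ is an isolated efficient solution of $(P)$ if there is a constant $\nu>0$ such that $\max_{i\in I}\{f_i(x)-f_i(\widehat{x})\}\ge\nu\|x-\widehat{x}\|$ for all $x\in S$ (Euclidean norm). The perturbed KKT condition holds at $\widehat{x}\in S$ when there exists a scalar $\nu>0$ such that for any $w\in\nu\mathbb{B}_n$ there exist $\alpha_i\ge0$ ($i\in I$) with $\sum_{i=1}^p\alpha_i=1$, a finite set $T^\ast\subseteq T(\widehat{x})$, and scalars $\beta_t\ge0$ ($t\in T^\ast$) such that $w\in\sum_{i=1}^p\alpha_i\partial f_i(\widehat{x})+\sum_{t\in T^\ast}\beta_t\partial g_t(\widehat{x})$. Here $\mathbb{B}_n$ is the closed Euclidean unit ball, $\partial$ is the Fenchel–Moreau subdifferential and $T(\widehat{x}):=\{t\in T\mid g_t(\widehat{x})=0\}$. *)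

theory Defs
  imports "HOL-Analysis.Analysis"
begin

text \<open>Functions into \<open>\<real> \<union> {+\<infinity>}\<close> are modelled as \<^typ>\<open>ereal\<close>-valued functions that
  never take the value \<open>-\<infinity>\<close>; this is part of \<open>proper_fun\<close>.\<close>

definition proper_fun :: "('a \<Rightarrow> ereal) \<Rightarrow> bool" where
  "proper_fun g \<longleftrightarrow> (\<forall>x. g x \<noteq> -\<infinity>) \<and> (\<exists>x. g x \<noteq> \<infinity>)"

text \<open>For \<open>ereal\<close> one has \<open>0 * \<infinity> = 0\<close>, so the cases \<open>u = 0\<close> and \<open>v = 0\<close> hold trivially.
  The sum on the right is only meaningful for functions avoiding \<open>-\<infinity>\<close>.\<close>

definition convex_fun :: "('a::real_vector \<Rightarrow> ereal) \<Rightarrow> bool" where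
  "convex_fun g \<longleftrightarrow> (\<forall>x y. \<forall>u\<ge>0. \<forall>v\<ge>0. u + v = 1 \<longrightarrow>
     g (u *\<^sub>R x + v *\<^sub>R y) \<le> ereal u * g x + ereal v * g y)"

definition lower_semicontinuous :: "('a::topological_space \<Rightarrow> ereal) \<Rightarrow> bool" where
  "lower_semicontinuous g \<longleftrightarrow> (\<forall>x. g x \<le> Liminf (at x) g)"

text \<open>The Fenchel-Moreau subdifferential; it is empty at points outside the effective domain.\<close>

definition subdifferential :: "('a::real_inner \<Rightarrow> ereal) \<Rightarrow> 'a \<Rightarrow> 'a set" where
  "subdifferential g x0 =
     {v. \<bar>g x0\<bar> \<noteq> \<infinity> \<and> (\<forall>x. g x \<ge> g x0 + ereal (v \<bullet> (x - x0)))}"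

definition feasible_set :: "'t set \<Rightarrow> ('t \<Rightarrow> 'a \<Rightarrow> ereal) \<Rightarrow> 'a set" where
  "feasible_set T g = {x. \<forall>t\<in>T. g t x \<le> 0}"

definition active_set :: "'t set \<Rightarrow> ('t \<Rightarrow> 'a \<Rightarrow> ereal) \<Rightarrow> 'a \<Rightarrow> 't set" where
  "active_set T g x = {t\<in>T. g t x = 0}"

definition isolated_efficient ::
  "nat \<Rightarrow> (nat \<Rightarrow> 'a::real_normed_vector \<Rightarrow> real) \<Rightarrow> 't set \<Rightarrow> ('t \<Rightarrow> 'a \<Rightarrow> ereal) \<Rightarrow> 'a \<Rightarrow> bool" where
  "isolated_efficient p f T g xh \<longleftrightarrow>
     xh \<in> feasible_set T g \<and>
     (\<exists>\<nu>>0. \<forall>x\<in>feasible_set T g. Max ((\<lambda>i. f i x - f i xh) ` {1..p}) \<ge> \<nu> * norm (x - xh))"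

text \<open>The sums of sets below are Minkowski sums; in particular the empty sum is \<open>{0}\<close>,
  and a sum with an empty summand is empty, even if that summand is scaled by \<open>0\<close>.\<close>

definition perturbed_KKT ::
  "nat \<Rightarrow> (nat \<Rightarrow> 'a::real_inner \<Rightarrow> real) \<Rightarrow> 't set \<Rightarrow> ('t \<Rightarrow> 'a \<Rightarrow> ereal) \<Rightarrow> 'a \<Rightarrow> bool" where
  "perturbed_KKT p f T g xh \<longleftrightarrow>
     (\<exists>\<nu>>0. \<forall>w \<in> (\<lambda>b. \<nu> *\<^sub>R b) ` cball 0 1.
        \<exists>\<alpha> Ts \<beta>.
          (\<forall>i\<in>{1..p}. \<alpha> i \<ge> 0) \<and> (\<Sum>i=1..p. \<alpha> i) = 1 \<and>
          finite Ts \<and> Ts \<subseteq> active_set T g xh \<and> (\<forall>t\<in>Ts. \<beta> t \<ge> 0) \<and>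
          w \<in> (\<Sum>i=1..p. (\<lambda>v. \<alpha> i *\<^sub>R v) ` subdifferential (\<lambda>x. ereal (f i x)) xh)
            + (\<Sum>t\<in>Ts. (\<lambda>v. \<beta> t *\<^sub>R v) ` subdifferential (g t) xh))"

end

theory Submission
  imports Defs
begin

text \<open>
  Fix a feasible point \<open>x\<close> and put \<open>d = x - xh\<close>. The hypothesis may be applied to the perturbation
  \<open>w\<close> of length at most \<open>\<nu>\<close> that points from \<open>xh\<close> towards \<open>x\<close>, so that \<open>w \<bullet> d = \<nu> * norm d\<close>. Writing
  \<open>w\<close> as a nonnegative combination of subgradients bounds the same number from above. A subgradient
  of \<open>f i\<close> has inner product at most \<open>f i x - f i xh\<close> with \<open>d\<close>, hence at most the maximum of these
  differences, and the weights of these terms sum to \<open>1\<close>. A subgradient of an active constraint has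
  inner product at most \<open>0\<close> with \<open>d\<close>, because \<open>g t x \<le> 0 = g t xh\<close>. So \<open>\<nu> * norm d\<close> is at most the
  maximum, and the constant of the perturbed condition serves as the constant of isolated efficiency.
\<close>

text \<open>Support functions in the direction \<open>d\<close> add up under Minkowski sums and scale with nonnegative
  factors. Upper bounds \<open>c i\<close> stand in for the suprema, so that an empty \<open>A i\<close> needs no
  separate treatment.\<close>

lemma inner_le_of_mem_sum_scaled:
  fixes A :: "'i \<Rightarrow> 'a::real_inner set" and d :: 'a
  assumes fin: "finite I"
    and w: "w \<in> (\<Sum>i\<in>I. (\<lambda>v. a i *\<^sub>R v) ` A i)"
    and a: "\<And>i. i \<in> I \<Longrightarrow> a i \<ge> 0"
    and bound: "\<And>i v. i \<in> I \<Longrightarrow> v \<in> A i \<Longrightarrow> v \<bullet> d \<le> c i"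
  shows "w \<bullet> d \<le> (\<Sum>i\<in>I. a i * c i)"
proof -
  obtain s where ws: "w = sum s I" and s: "\<And>i. i \<in> I \<Longrightarrow> s i \<in> (\<lambda>v. a i *\<^sub>R v) ` A i"
    using w unfolding set_sum_alt[OF fin] by auto
  have "s i \<bullet> d \<le> a i * c i" if "i \<in> I" for i
    using s[OF that] bound[OF that] a[OF that] by (auto intro!: mult_left_mono)
  then show ?thesis
    unfolding ws inner_sum_left by (rule sum_mono)
qed

lemma subgradient_inner_le_real:
  assumes "v \<in> subdifferential (\<lambda>x. ereal (h x)) x0"
  shows "v \<bullet> (x - x0) \<le> h x - h x0"
proof -
  have "ereal (h x0) + ereal (v \<bullet> (x - x0)) \<le> ereal (h x)"
    using assms by (simp add: subdifferential_def)
  then show ?thesis by simp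
qed

lemma active_subgradient_inner_le_0:
  assumes "t \<in> active_set T g x0" and "v \<in> subdifferential (g t) x0" and "x \<in> feasible_set T g"
  shows "v \<bullet> (x - x0) \<le> 0"
proof -
  have "t \<in> T" and "g t x0 = 0"
    using assms(1) by (auto simp: active_set_def)
  then have "ereal (v \<bullet> (x - x0)) \<le> g t x"
    using assms(2) by (simp add: subdifferential_def)
  also have "\<dots> \<le> 0"
    using assms(3) \<open>t \<in> T\<close> by (simp add: feasible_set_def)
  finally show ?thesis by simp
qed

theorem theorem10:
  fixes p :: nat
    and f :: "nat \<Rightarrow> real ^ 'n \<Rightarrow> real"
    and T :: "'t set"
    and g :: "'t \<Rightarrow> real ^ 'n \<Rightarrow> ereal"
    and xh :: "real ^ 'n"
  assumes "p \<ge> 2"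
    and "\<And>i. i \<in> {1..p} \<Longrightarrow> convex_on UNIV (f i)"
    and "infinite T"
    and "\<And>t. t \<in> T \<Longrightarrow> lower_semicontinuous (g t)"
    and "\<And>t. t \<in> T \<Longrightarrow> proper_fun (g t)"
    and "\<And>t. t \<in> T \<Longrightarrow> convex_fun (g t)"
    and "feasible_set T g \<noteq> {}"
    and "xh \<in> feasible_set T g"
    and "perturbed_KKT p f T g xh"
  shows "isolated_efficient p f T g xh"
proof -
  obtain \<nu> where "\<nu> > 0" and KKT: "\<forall>w \<in> (\<lambda>b. \<nu> *\<^sub>R b) ` cball 0 1. \<exists>\<alpha> Ts \<beta>.
      (\<forall>i\<in>{1..p}. \<alpha> i \<ge> 0) \<and> (\<Sum>i=1..p. \<alpha> i) = 1 \<and>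
      finite Ts \<and> Ts \<subseteq> active_set T g xh \<and> (\<forall>t\<in>Ts. \<beta> t \<ge> 0) \<and>
      w \<in> (\<Sum>i=1..p. (\<lambda>v. \<alpha> i *\<^sub>R v) ` subdifferential (\<lambda>x. ereal (f i x)) xh)
        + (\<Sum>t\<in>Ts. (\<lambda>v. \<beta> t *\<^sub>R v) ` subdifferential (g t) xh)"
    using assms(9) unfolding perturbed_KKT_def by auto
  have "\<nu> * norm (x - xh) \<le> Max ((\<lambda>i. f i x - f i xh) ` {1..p})"
    if x: "x \<in> feasible_set T g" for x
  proof -
    define d where "d = x - xh"
    define m where "m = Max ((\<lambda>i. f i x - f i xh) ` {1..p})"
    \<comment> \<open>Since \<open>sgn 0 = 0\<close>, this choice also covers \<open>x = xh\<close>.\<close>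
    define w where "w = \<nu> *\<^sub>R sgn d"
    have "w \<in> (\<lambda>b. \<nu> *\<^sub>R b) ` cball 0 1"
      unfolding w_def by (intro imageI) (simp add: norm_sgn)
    with KKT obtain \<alpha> Ts \<beta> where
      \<alpha>: "\<And>i. i \<in> {1..p} \<Longrightarrow> \<alpha> i \<ge> 0" "(\<Sum>i=1..p. \<alpha> i) = 1"
      and Ts: "finite Ts" "Ts \<subseteq> active_set T g xh" and \<beta>: "\<And>t. t \<in> Ts \<Longrightarrow> \<beta> t \<ge> 0"
      and w: "w \<in> (\<Sum>i=1..p. (\<lambda>v. \<alpha> i *\<^sub>R v) ` subdifferential (\<lambda>x. ereal (f i x)) xh)
        + (\<Sum>t\<in>Ts. (\<lambda>v. \<beta> t *\<^sub>R v) ` subdifferential (g t) xh)"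
      by blast
    obtain a b where ab: "w = a + b"
      and a: "a \<in> (\<Sum>i=1..p. (\<lambda>v. \<alpha> i *\<^sub>R v) ` subdifferential (\<lambda>x. ereal (f i x)) xh)"
      and b: "b \<in> (\<Sum>t\<in>Ts. (\<lambda>v. \<beta> t *\<^sub>R v) ` subdifferential (g t) xh)"
      using w by (rule set_plus_elim)
    have "v \<bullet> d \<le> m" if "i \<in> {1..p}" and "v \<in> subdifferential (\<lambda>x. ereal (f i x)) xh" for i v
    proof -
      have "v \<bullet> d \<le> f i x - f i xh"
        unfolding d_def using that(2) by (rule subgradient_inner_le_real)
      also have "\<dots> \<le> m"
        unfolding m_def using that(1) by (intro Max_ge) auto
      finally show ?thesis .
    qed
    then have "a \<bullet> d \<le> (\<Sum>i=1..p. \<alpha> i * m)"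
      using a \<alpha>(1) by (intro inner_le_of_mem_sum_scaled) auto
    then have am: "a \<bullet> d \<le> m"
      unfolding sum_distrib_right[symmetric] \<alpha>(2) by simp
    have "v \<bullet> d \<le> 0" if "t \<in> Ts" and "v \<in> subdifferential (g t) xh" for t v
      unfolding d_def using that Ts(2) x by (blast intro: active_subgradient_inner_le_0)
    then have "b \<bullet> d \<le> (\<Sum>t\<in>Ts. \<beta> t * 0)"
      by (intro inner_le_of_mem_sum_scaled[OF Ts(1) b \<beta>]) auto
    then have b0: "b \<bullet> d \<le> 0"
      by simp
    have "\<nu> * norm d = w \<bullet> d"
      by (cases "d = 0") (simp_all add: w_def sgn_div_norm dot_square_norm power2_eq_square)
    also have "\<dots> \<le> m"
      using am b0 by (simp add: ab inner_add_left)
    finally show ?thesis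
      unfolding d_def m_def .
  qed
  with assms(8) \<open>\<nu> > 0\<close> show ?thesis
    unfolding isolated_efficient_def by blast
qed

end
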